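(* Let $k\ge 1$. The number of unordered positions $\{a,b,a+b\}$, where $\{a,b\}$ is an unordered pair of positive integers with $a\oplus b\oplus(a+b)=0$, in which two of the three piles have exactly $k$ binary digits, equals $3^{k-1}-2^{k-1}$.
   Context: $\oplus$ denotes bitwise exclusive-or. The number of binary digits of a positive integer $n$ is $\lfloor \log_2 n\rfloor+1$. *)

theory Defs
  imports Complex_Main "HOL-Library.Multiset" "HOL-Library.Log_Nat"
begin

unbundle bit_operations_syntax

text \<open>Positions are multisets of piles, so the order of the piles is immaterial.\<close>

definition sum_positions :: "nat multiset set" where
  "sum_positions = {{#a, b, a + b#} | a b. a > 0 \<and> b > 0 \<and> a XOR b XOR (a + b) = 0}"

text \<open>For \<open>n > 0\<close>, \<open>floorlog 2 n = nat \<lfloor>log 2 n\<rfloor> + 1\<close> is the number of binary digits of \<open>n\<close>.\<close>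

definition piles_with_digits :: "nat \<Rightarrow> nat multiset \<Rightarrow> nat multiset" where
  "piles_with_digits k M = {#n \<in># M. floorlog 2 n = k#}"

end

theory Submission
  imports Defs
begin

text \<open>
  Adding without carries means that \<open>a\<close> and \<open>b\<close> share no binary digit, so the larger summand alone
  carries the leading digit \<open>2 ^ m\<close> (with \<open>m = k - 1\<close>), which is also the leading digit of the sum.
  Removing it leaves a pair of digit-disjoint numbers below \<open>2 ^ m\<close>. Each of the \<open>m\<close> digits allows three
  choices, giving \<open>3 ^ m\<close> pairs, of which \<open>2 ^ m\<close> have the smaller summand equal to zero.
\<close>

text \<open>XOR adds digitwise without carrying, and AND marks the positions that produce a carry,
  each worth twice its place value. Halving both numbers reduces the claim to the last
  digits.\<close>

lemma add_eq_xor_add_double_and: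
  "a + b = (a XOR b) + 2 * (a AND b)" for a b :: nat
proof (induction a arbitrary: b rule: less_induct)
  case (less a)
  show ?case
  proof (cases "a = 0")
    case False
    then have IH: "a div 2 + b div 2 = (a div 2 XOR b div 2) + 2 * (a div 2 AND b div 2)"
      using less[of "a div 2" "b div 2"] by simp
    have "a XOR b = of_bool (odd a \<noteq> odd b) + 2 * (a div 2 XOR b div 2)"
      by (rule xor_rec)
    moreover have "a AND b = of_bool (odd a \<and> odd b) + 2 * (a div 2 AND b div 2)"
      by (rule and_rec)
    moreover have "a = of_bool (odd a) + 2 * (a div 2)" "b = of_bool (odd b) + 2 * (b div 2)"
      by (auto simp: odd_two_times_div_two_succ)
    moreover have "of_bool (odd a) + of_bool (odd b) =
        (of_bool (odd a \<noteq> odd b) + 2 * of_bool (odd a \<and> odd b) :: nat)"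
      by simp
    ultimately show ?thesis using IH by linarith
  qed simp
qed

text \<open>XOR is its own inverse, so the condition says \<open>a XOR b = a + b\<close>: the carry
  term vanishes.\<close>

lemma xor_add_eq_0_iff: "a XOR b XOR (a + b) = 0 \<longleftrightarrow> a AND b = 0" for a b :: nat
proof -
  have "x XOR y = 0 \<longleftrightarrow> x = y" for x y :: nat
    by (metis xor.assoc xor.left_neutral xor.right_neutral xor_self_eq)
  then have "a XOR b XOR (a + b) = 0 \<longleftrightarrow> a XOR b = a + b"
    by (metis xor.assoc)
  then show ?thesis using add_eq_xor_add_double_and[of a b] by auto
qed

text \<open>Without carries the sum is the XOR, which has no digit at position \<open>m\<close> or
  above.\<close>

lemma add_less_power_if_and_eq_0:
  fixes a b :: nat
  assumes "a AND b = 0" "a < 2 ^ m" "b < 2 ^ m"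
  shows "a + b < 2 ^ m"
proof -
  have "a + b = a XOR b"
    using add_eq_xor_add_double_and[of a b] assms by simp
  moreover have "take_bit m (a XOR b) = a XOR b"
    using assms by (simp add: take_bit_nat_eq_self)
  ultimately show ?thesis
    by (metis take_bit_nat_less_exp)
qed

text \<open>The digit \<open>2 ^ m\<close> lies above every digit of \<open>a\<close>, so truncating
  the other operand to \<open>m\<close> digits leaves the AND unchanged.\<close>

lemma and_power_add:
  fixes a c :: nat
  assumes "a < 2 ^ m" "c < 2 ^ m"
  shows "a AND (2 ^ m + c) = a AND c"
proof -
  have a: "take_bit m a = a" using assms by (simp add: take_bit_nat_eq_self)
  have c: "take_bit m (2 ^ m + c) = c" using assms by (simp add: take_bit_eq_mod)
  have "a AND (2 ^ m + c) = take_bit m a AND (2 ^ m + c)" by (simp add: a)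
  also have "\<dots> = take_bit m a AND take_bit m (2 ^ m + c)"
    by (rule bit_eqI) (auto simp: bit_simps)
  finally show ?thesis by (simp add: a c)
qed

lemma and_neq_0_if_same_leading_digit:
  fixes a b :: nat
  assumes "2 ^ m \<le> a" "a < 2 ^ Suc m" "2 ^ m \<le> b" "b < 2 ^ Suc m"
  shows "a AND b \<noteq> 0"
proof -
  have "bit x m" if "2 ^ m \<le> x" "x < 2 ^ Suc m" for x :: nat
  proof -
    have "x div 2 ^ m = 1"
      using that by (intro div_nat_eqI) auto
    then show ?thesis by (simp add: bit_iff_odd)
  qed
  then have "bit (a AND b) m" using assms by (simp add: bit_and_iff)
  then show ?thesis by (metis bit_0_eq bot_apply bot_bool_def)
qed

lemma floorlog_2_eq_Suc_iff: "floorlog 2 n = Suc m \<longleftrightarrow> 2 ^ m \<le> n \<and> n < 2 ^ Suc m"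
proof
  assume *: "floorlog 2 n = Suc m"
  \<comment> \<open>\<open>floorlog 2 0 = 0\<close>, so a successor value excludes
    \<open>n = 0\<close>.\<close>
  then have "n > 0" by (cases n) (auto simp: floorlog_def)
  then show "2 ^ m \<le> n \<and> n < 2 ^ Suc m"
    using floorlog_bounds[of n 2] * by auto
next
  assume *: "2 ^ m \<le> n \<and> n < 2 ^ Suc m"
  then have "n > 0" by (metis gr0I not_le zero_less_numeral zero_less_power)
  then show "floorlog 2 n = Suc m"
    using * floorlog_le_iff[of 2 n "Suc m"] floorlog_le_iff[of 2 n m] by (simp add: not_le le_antisym)
qed

definition disjoint_pairs :: "nat \<Rightarrow> (nat \<times> nat) set" where
  "disjoint_pairs m = {(a, c). a < 2 ^ m \<and> c < 2 ^ m \<and> a AND c = 0}"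

lemma finite_disjoint_pairs: "finite (disjoint_pairs m)"
  by (rule finite_subset[of _ "{..<2 ^ m} \<times> {..<2 ^ m}"]) (auto simp: disjoint_pairs_def)

lemma card_disjoint_pairs: "card (disjoint_pairs m) = 3 ^ m"
proof (induction m)
  case 0
  have "disjoint_pairs 0 = {(0, 0)}" by (auto simp: disjoint_pairs_def)
  then show ?case by simp
next
  case (Suc m)
  let ?D = "{(0, 0), (0, 1), (1, 0)} :: (nat \<times> nat) set"
  \<comment> \<open>Appending a last digit to each component: every combination except
    \<open>(1, 1)\<close> keeps the pair disjoint, hence the factor 3.\<close>
  have "bij_betw (\<lambda>((a, c), (i, j)). (2 * a + i, 2 * c + j)) (disjoint_pairs m \<times> ?D) (disjoint_pairs (Suc m))"
  proof (rule bij_betw_byWitness[where f' = "\<lambda>(a, c). ((a div 2, c div 2), (a mod 2, c mod 2))"])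
    show "(\<lambda>((a, c), (i, j)). (2 * a + i, 2 * c + j)) ` (disjoint_pairs m \<times> ?D) \<subseteq> disjoint_pairs (Suc m)"
    proof -
      have "2 * a AND 2 * c = 2 * (a AND c)" "2 * a AND Suc (2 * c) = 2 * (a AND c)"
        "Suc (2 * a) AND 2 * c = 2 * (a AND c)" for a c :: nat
        using and_rec[of "2 * a" "2 * c"] and_rec[of "2 * a" "Suc (2 * c)"]
          and_rec[of "Suc (2 * a)" "2 * c"] by simp_all
      then show ?thesis by (auto simp: disjoint_pairs_def)
    qed
    show "(\<lambda>(a, c). ((a div 2, c div 2), (a mod 2, c mod 2))) ` disjoint_pairs (Suc m) \<subseteq> disjoint_pairs m \<times> ?D"
    proof (clarsimp simp: disjoint_pairs_def)
      fix a c :: nat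
      assume *: "a < 2 * 2 ^ m" "c < 2 * 2 ^ m" "a AND c = 0"
      then have "\<not> (odd a \<and> odd c)" "a div 2 AND c div 2 = 0"
        using and_rec[of a c] by auto
      with * show "a div 2 < 2 ^ m \<and> c div 2 < 2 ^ m \<and> a div 2 AND c div 2 = 0 \<and>
        (a mod 2 = 0 \<and> c mod 2 = 0 \<or> a mod 2 = 0 \<and> c mod 2 = Suc 0 \<or> a mod 2 = Suc 0 \<and> c mod 2 = 0)"
        by (auto simp: odd_iff_mod_2_eq_one)
    qed
  qed auto
  then have "card (disjoint_pairs (Suc m)) = card (disjoint_pairs m \<times> ?D)"
    by (simp add: bij_betw_same_card)
  then show ?case using Suc by (simp add: card_cartesian_product)
qed

lemma card_disjoint_pairs_pos: "card {(a, c) \<in> disjoint_pairs m. a > 0} = 3 ^ m - 2 ^ m"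
proof -
  have eq: "{(a, c) \<in> disjoint_pairs m. a > 0} = disjoint_pairs m - {0} \<times> {..<2 ^ m}"
    by (auto simp: disjoint_pairs_def)
  have sub: "{0} \<times> {..<2 ^ m} \<subseteq> disjoint_pairs m"
    by (auto simp: disjoint_pairs_def)
  show ?thesis
    unfolding eq using sub
    by (simp add: card_Diff_subset finite_subset[OF sub finite_disjoint_pairs] card_disjoint_pairs card_cartesian_product)
qed

definition extend_pair :: "nat \<Rightarrow> nat \<times> nat \<Rightarrow> nat multiset" where
  "extend_pair m = (\<lambda>(a, c). {#a, 2 ^ m + c, a + (2 ^ m + c)#})"

text \<open>The multiset determines \<open>a\<close> as its only pile below \<open>2 ^ m\<close>;
  then the total \<open>2 * (a + 2 ^ m + c)\<close> determines \<open>c\<close>.\<close>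

lemma inj_on_extend_pair: "inj_on (extend_pair m) (disjoint_pairs m)"
proof (rule inj_onI, clarify)
  fix a c a' c'
  assume "(a, c) \<in> disjoint_pairs m" "(a', c') \<in> disjoint_pairs m"
    and eq: "extend_pair m (a, c) = extend_pair m (a', c')"
  then have "a < 2 ^ m" "a' < 2 ^ m" by (auto simp: disjoint_pairs_def)
  then have "filter_mset (\<lambda>n. n < 2 ^ m) (extend_pair m (a, c)) = {#a#}"
    "filter_mset (\<lambda>n. n < 2 ^ m) (extend_pair m (a', c')) = {#a'#}"
    by (auto simp: extend_pair_def)
  with eq have "a = a'" by simp
  moreover have "sum_mset (extend_pair m (a, c)) = sum_mset (extend_pair m (a', c'))"
    using eq by simp
  ultimately show "a = a' \<and> c = c'" by (simp add: extend_pair_def)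
qed

lemma positions_with_two_piles_eq:
  "{M \<in> sum_positions. size (piles_with_digits (Suc m) M) = 2} =
    extend_pair m ` {(a, c) \<in> disjoint_pairs m. a > 0}" (is "?L = ?R")
proof (rule set_eqI, rule iffI)
  fix M
  assume "M \<in> ?R"
  then obtain a c where *: "a < 2 ^ m" "c < 2 ^ m" "a AND c = 0" "a > 0"
    and M: "M = {#a, 2 ^ m + c, a + (2 ^ m + c)#}"
    by (auto simp: disjoint_pairs_def extend_pair_def)
  \<comment> \<open>Hence \<open>a + (2 ^ m + c)\<close> stays below \<open>2 ^ Suc m\<close> and
    has as many digits as \<open>2 ^ m + c\<close>, while \<open>a\<close> has fewer.\<close>
  have "a + c < 2 ^ m" using * by (intro add_less_power_if_and_eq_0)
  then have "size (piles_with_digits (Suc m) M) = 2"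
    using * unfolding M piles_with_digits_def by (simp add: floorlog_2_eq_Suc_iff)
  moreover have "a AND (2 ^ m + c) = 0" using * by (simp add: and_power_add)
  then have "M \<in> sum_positions"
    unfolding sum_positions_def M xor_add_eq_0_iff using * by (intro CollectI exI[of _ a] exI[of _ "2 ^ m + c"]) auto
  ultimately show "M \<in> ?L" by simp
next
  fix M
  assume "M \<in> ?L"
  then obtain a b where ab: "a > 0" "b > 0" "a AND b = 0" and M: "M = {#a, b, a + b#}"
    and size: "size (piles_with_digits (Suc m) M) = 2"
    by (auto simp: sum_positions_def xor_add_eq_0_iff)
  define lead where "lead x \<longleftrightarrow> 2 ^ m \<le> x \<and> x < 2 ^ Suc m" for x :: nat
  \<comment> \<open>Stated for arbitrary \<open>x\<close> and \<open>y\<close> because either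
    \<open>a\<close> or \<open>b\<close> may be the larger summand.\<close>
  have in_R: "{#x, y, x + y#} \<in> ?R"
    if "x > 0" "x AND y = 0" "\<not> lead x" "lead y" "lead (x + y)" for x y
  proof -
    define c where "c = y - 2 ^ m"
    \<comment> \<open>Since \<open>x\<close> is at most \<open>x + y < 2 ^ Suc m\<close>, it can
      fail \<open>lead\<close> only by lying below \<open>2 ^ m\<close>.\<close>
    have y: "y = 2 ^ m + c" and c: "c < 2 ^ m" and x: "x < 2 ^ m"
      using that by (auto simp: lead_def c_def)
    then have "x AND c = 0" using that(2) and_power_add[OF x c] by simp
    then have "(x, c) \<in> {(a, c) \<in> disjoint_pairs m. a > 0}"
      using x c that(1) by (simp add: disjoint_pairs_def)
    moreover have "{#x, y, x + y#} = extend_pair m (x, c)"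
      by (simp add: extend_pair_def y)
    ultimately show ?thesis by blast
  qed
  \<comment> \<open>Both summands would share the digit at position \<open>m\<close>. So the two
    piles with \<open>Suc m\<close> digits are the sum and exactly one summand.\<close>
  have "\<not> (lead a \<and> lead b)"
    using and_neq_0_if_same_leading_digit ab(3) unfolding lead_def by blast
  moreover have "size {#n \<in># M. lead n#} = 2"
    using size by (simp add: piles_with_digits_def floorlog_2_eq_Suc_iff lead_def)
  ultimately have "\<not> lead a \<and> lead b \<and> lead (a + b) \<or> \<not> lead b \<and> lead a \<and> lead (a + b)"
    unfolding M by (auto split: if_splits)
  then show "M \<in> ?R"
  proof
    assume "\<not> lead a \<and> lead b \<and> lead (a + b)"
    then show ?thesis using in_R[of a b] ab M by simp
  next
    assume "\<not> lead b \<and> lead a \<and> lead (a + b)"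
    then show ?thesis using in_R[of b a] ab M
      by (simp add: and.commute add.commute add_mset_commute)
  qed
qed

theorem theorem7p7:
  fixes k :: nat
  assumes "k \<ge> 1"
  shows "finite {M \<in> sum_positions. size (piles_with_digits k M) = 2} \<and>
    card {M \<in> sum_positions. size (piles_with_digits k M) = 2} = 3 ^ (k - 1) - 2 ^ (k - 1)"
proof -
  obtain m where k: "k = Suc m" using assms by (cases k) auto
  let ?P = "{(a, c) \<in> disjoint_pairs m. a > 0}"
  have sub: "?P \<subseteq> disjoint_pairs m" by auto
  note finite_subset[OF sub finite_disjoint_pairs] inj_on_subset[OF inj_on_extend_pair sub]
  then show ?thesis
    unfolding k positions_with_two_piles_eq
    by (simp add: card_image card_disjoint_pairs_pos)
qed

end
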